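(* Let $(Z,d)$ be a finite ep-metric space, and suppose that each $x \in Z$ has a fixed complete neighbourhood $N_x = Z(x,r_x)$. Let $N = \{N_x\}_{x \in Z}$, with ray complex $R(N)$ and neighbourhood complex $V(N)$. 1) Suppose that $t \leq r_x$ for all $x \in Z$. Then the functions $\pi_0 R_t(N) \to \pi_0 V_t(N) \to \pi_0 V_t(Z)$ are bijections. 2) Suppose that $t \geq r_x$ for all $x \in Z$. Then the map $\pi_0 R_t(N) \to \pi_0 V_t(N)$ is a bijection. 3) Suppose that $t \geq S \geq r_x$ for all $x \in Z$. Then the map $\pi_0 R_S(N) \to \pi_0 R_t(N)$ is a bijection.
   Context: An ep-metric space (extended pseudo-metric space) $(Z,d)$ is a set $Z$ with a function $d : Z\times Z \to [0,\infty]$ such that $d(x,x)=0$, $d(x,y)=d(y,x)$ and $d(x,z) \leq d(x,y)+d(y,z)$. Distinct points may have distance $0$, and distances may be infinite. A neighbourhood of $x \in Z$ is a subset $N \subset Z$ with $x \in N$ and $d(x,y)<\infty$ for all $y \in N$; its radius is $s(N)=\max_{y\in N} d(x,y)$. Write $Z(x,s)=\{y \in Z \mid d(x,y) \leq s\}$. A neighbourhood $N$ of $x$ is complete if $N = Z(x,s(N))$. Here the $r_x$, $S$ and $t$ are real numbers $\geq 0$. For a subset $M \subset Z$ and $t \geq 0$, $V_t(M)$ is the Vietoris-Rips complex: the abstract simplicial complex whose simplices are the non-empty finite subsets $\sigma \subset M$ with $d(u,v)\leq t$ for all $u,v\in\sigma$. For a family $N = \{N_x\}$ of neighbourhoods,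 one for each $x\in Z$, the neighbourhood complex is $V_t(N) = \bigcup_{x \in Z} V_t(N_x) \subset V_t(Z)$, and the ray complex $R_t(N) \subset V_t(N)$ is the graph with vertex set $Z$ and with an edge $\{x,y\}$ whenever $y \in N_x-\{x\}$ and $d(x,y) \leq t$ (for one of the two orderings of the pair). $\pi_0$ denotes the set of path components, and all maps are induced by inclusions. *)

theory Defs
  imports "HOL-Analysis.Analysis"
begin

definition ep_metric_on :: "'a set \<Rightarrow> ('a \<Rightarrow> 'a \<Rightarrow> ennreal) \<Rightarrow> bool" where
  "ep_metric_on Z d \<longleftrightarrow>
     (\<forall>x\<in>Z. d x x = 0) \<and>
     (\<forall>x\<in>Z. \<forall>y\<in>Z. d x y = d y x) \<and>
     (\<forall>x\<in>Z. \<forall>y\<in>Z. \<forall>z\<in>Z. d x z \<le> d x y + d y z)"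

definition ep_cball :: "'a set \<Rightarrow> ('a \<Rightarrow> 'a \<Rightarrow> ennreal) \<Rightarrow> 'a \<Rightarrow> ennreal \<Rightarrow> 'a set" where
  "ep_cball Z d x s = {y \<in> Z. d x y \<le> s}"

definition ep_nbhd :: "'a set \<Rightarrow> ('a \<Rightarrow> 'a \<Rightarrow> ennreal) \<Rightarrow> 'a \<Rightarrow> 'a set \<Rightarrow> bool" where
  "ep_nbhd Z d x N \<longleftrightarrow> N \<subseteq> Z \<and> x \<in> N \<and> (\<forall>y\<in>N. d x y < \<infinity>)"

text \<open>The maximum is only meaningful for finite \<open>N\<close>, hence for every neighbourhood in a finite space.\<close>

definition nbhd_radius :: "('a \<Rightarrow> 'a \<Rightarrow> ennreal) \<Rightarrow> 'a \<Rightarrow> 'a set \<Rightarrow> ennreal" where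
  "nbhd_radius d x N = Max (d x ` N)"

definition complete_nbhd :: "'a set \<Rightarrow> ('a \<Rightarrow> 'a \<Rightarrow> ennreal) \<Rightarrow> 'a \<Rightarrow> 'a set \<Rightarrow> bool" where
  "complete_nbhd Z d x N \<longleftrightarrow> ep_nbhd Z d x N \<and> N = ep_cball Z d x (nbhd_radius d x N)"

text \<open>Abstract simplicial complexes are represented by their sets of simplices. Scale parameters
  are nonnegative reals; \<open>ennreal\<close> sends negative reals to \<open>0\<close>.\<close>

definition rips_complex :: "('a \<Rightarrow> 'a \<Rightarrow> ennreal) \<Rightarrow> real \<Rightarrow> 'a set \<Rightarrow> 'a set set" where
  "rips_complex d t M =
     {\<sigma>. \<sigma> \<noteq> {} \<and> finite \<sigma> \<and> \<sigma> \<subseteq> M \<and> (\<forall>u\<in>\<sigma>. \<forall>v\<in>\<sigma>. d u v \<le> ennreal t)}"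

definition nbhd_complex ::
  "'a set \<Rightarrow> ('a \<Rightarrow> 'a \<Rightarrow> ennreal) \<Rightarrow> ('a \<Rightarrow> 'a set) \<Rightarrow> real \<Rightarrow> 'a set set" where
  "nbhd_complex Z d N t = (\<Union>x\<in>Z. rips_complex d t (N x))"

definition ray_complex ::
  "'a set \<Rightarrow> ('a \<Rightarrow> 'a \<Rightarrow> ennreal) \<Rightarrow> ('a \<Rightarrow> 'a set) \<Rightarrow> real \<Rightarrow> 'a set set" where
  "ray_complex Z d N t =
     {{x} | x. x \<in> Z} \<union>
     {{x, y} | x y. x \<in> Z \<and> y \<in> N x - {x} \<and> d x y \<le> ennreal t}"

text \<open>Points of the geometric realization are given by their barycentric coordinates, extended by
  \<open>0\<close> off the simplex. Every closed simplex carries the topology of pointwise convergence (the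
  Euclidean one, as simplices are finite), and the realization carries the coherent (weak)
  topology. With these coordinates, the map of realizations induced by an inclusion \<open>K \<subseteq> L\<close> is
  itself a set inclusion.\<close>

definition geom_simplex :: "'a set \<Rightarrow> ('a \<Rightarrow> real) set" where
  "geom_simplex \<sigma> = {\<alpha>. (\<forall>v. 0 \<le> \<alpha> v) \<and> (\<forall>v. v \<notin> \<sigma> \<longrightarrow> \<alpha> v = 0) \<and> sum \<alpha> \<sigma> = 1}"

definition geom_realization :: "'a set set \<Rightarrow> ('a \<Rightarrow> real) topology" where
  "geom_realization K = topology (\<lambda>U. U \<subseteq> (\<Union>\<sigma>\<in>K. geom_simplex \<sigma>) \<and>
     (\<forall>\<sigma>\<in>K. openin (top_of_set (geom_simplex \<sigma>)) (U \<inter> geom_simplex \<sigma>)))"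

definition pi0 :: "'a set set \<Rightarrow> ('a \<Rightarrow> real) set set" where
  "pi0 K = path_components_of (geom_realization K)"

text \<open>The map \<open>pi0 K \<rightarrow> pi0 L\<close> induced by an inclusion \<open>K \<subseteq> L\<close>: a path component of the realization
  of \<open>K\<close> is sent to the path component of the realization of \<open>L\<close> that contains it.\<close>

definition pi0_incl :: "'a set set \<Rightarrow> ('a \<Rightarrow> real) set \<Rightarrow> ('a \<Rightarrow> real) set" where
  "pi0_incl L C = (THE D. D \<in> pi0 L \<and> C \<subseteq> D)"

lemma openin_geom_realization:
  "openin (geom_realization K) U \<longleftrightarrow> U \<subseteq> (\<Union>\<sigma>\<in>K. geom_simplex \<sigma>) \<and>
     (\<forall>\<sigma>\<in>K. openin (top_of_set (geom_simplex \<sigma>)) (U \<inter> geom_simplex \<sigma>))"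
proof -
  let ?P = "\<lambda>U. U \<subseteq> (\<Union>\<sigma>\<in>K. geom_simplex \<sigma>) \<and>
     (\<forall>\<sigma>\<in>K. openin (top_of_set (geom_simplex \<sigma>)) (U \<inter> geom_simplex \<sigma>))"
  have "istopology ?P"
    unfolding istopology_def
  proof (intro conjI allI impI)
    fix S T assume S: "?P S" and T: "?P T"
    then show "S \<inter> T \<subseteq> (\<Union>\<sigma>\<in>K. geom_simplex \<sigma>)" by blast
    show "\<forall>\<sigma>\<in>K. openin (top_of_set (geom_simplex \<sigma>)) (S \<inter> T \<inter> geom_simplex \<sigma>)"
    proof
      fix \<sigma> assume "\<sigma> \<in> K"
      then have "openin (top_of_set (geom_simplex \<sigma>))
          ((S \<inter> geom_simplex \<sigma>) \<inter> (T \<inter> geom_simplex \<sigma>))"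
        
        using S T by (meson openin_Int)
      then show "openin (top_of_set (geom_simplex \<sigma>)) (S \<inter> T \<inter> geom_simplex \<sigma>)"
        by (simp add: Int_ac)
    qed
  next
    fix \<U> assume U: "\<forall>U\<in>\<U>. ?P U"
    then show "\<Union>\<U> \<subseteq> (\<Union>\<sigma>\<in>K. geom_simplex \<sigma>)" by blast
    show "\<forall>\<sigma>\<in>K. openin (top_of_set (geom_simplex \<sigma>)) (\<Union>\<U> \<inter> geom_simplex \<sigma>)"
    proof
      fix \<sigma> assume "\<sigma> \<in> K"
      then have "\<And>U. U \<in> \<U> \<Longrightarrow> openin (top_of_set (geom_simplex \<sigma>)) (U \<inter> geom_simplex \<sigma>)"
        using U by blast
      then have "openin (top_of_set (geom_simplex \<sigma>)) (\<Union>U\<in>\<U>. U \<inter> geom_simplex \<sigma>)"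
        by (intro openin_Union) (erule imageE, simp only:)
      then show "openin (top_of_set (geom_simplex \<sigma>)) (\<Union>\<U> \<inter> geom_simplex \<sigma>)"
        by (simp only: Int_Union2)
    qed
  qed
  then show ?thesis
    unfolding geom_realization_def by (simp add: topology_inverse')
qed

lemma topspace_geom_realization: "topspace (geom_realization K) = (\<Union>\<sigma>\<in>K. geom_simplex \<sigma>)"
proof
  show "topspace (geom_realization K) \<subseteq> (\<Union>\<sigma>\<in>K. geom_simplex \<sigma>)"
    unfolding topspace_def openin_geom_realization by blast
  have "openin (geom_realization K) (\<Union>\<sigma>\<in>K. geom_simplex \<sigma>)"
    unfolding openin_geom_realization
    by (auto simp: Int_absorb1 UN_upper)
  then show "(\<Union>\<sigma>\<in>K. geom_simplex \<sigma>) \<subseteq> topspace (geom_realization K)"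
    by (rule openin_subset)
qed

lemma continuous_map_geom_realization_inclusion:
  assumes "K \<subseteq> L"
  shows "continuous_map (geom_realization K) (geom_realization L) (\<lambda>\<alpha>. \<alpha>)"
  unfolding continuous_map_def
proof (intro conjI allI impI)
  show "(\<lambda>\<alpha>. \<alpha>) \<in> topspace (geom_realization K) \<rightarrow> topspace (geom_realization L)"
    using assms by (auto simp: topspace_geom_realization)
next
  fix U assume U: "openin (geom_realization L) U"
  have "(topspace (geom_realization K) \<inter> U) \<inter> geom_simplex \<sigma> = U \<inter> geom_simplex \<sigma>"
    if "\<sigma> \<in> K" for \<sigma>
    using that by (auto simp: topspace_geom_realization)
  with U assms have "openin (geom_realization K) (topspace (geom_realization K) \<inter> U)"
    by (auto simp: openin_geom_realization[of _ U] openin_geom_realization[of K]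
        topspace_geom_realization)
  then show "openin (geom_realization K) {\<alpha> \<in> topspace (geom_realization K). \<alpha> \<in> U}"
    by (simp add: Int_def)
qed

lemma pi0_incl:
  assumes "K \<subseteq> L" and C: "C \<in> pi0 K"
  shows "pi0_incl L C \<in> pi0 L" and "C \<subseteq> pi0_incl L C"
proof -
  have ne: "C \<noteq> {}"
    using C unfolding pi0_def by (rule nonempty_path_components_of)
  have "path_connectedin (geom_realization L) ((\<lambda>\<alpha>. \<alpha>) ` C)"
    using C continuous_map_geom_realization_inclusion[OF assms(1)] unfolding pi0_def
    by (meson path_connectedin_continuous_map_image path_connectedin_path_components_of)
  then have pc: "path_connectedin (geom_realization L) C" by simp
  then obtain a where a: "a \<in> C" "a \<in> topspace (geom_realization L)"
    using ne path_connectedin_subset_topspace by blast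
  define D where "D = Collect (path_component_of (geom_realization L) a)"
  have D: "D \<in> pi0 L" "C \<subseteq> D"
    using a pc path_component_of_maximal[OF pc a(1)]
    by (auto simp: D_def pi0_def path_component_in_path_components_of)
  have "E = D" if E: "E \<in> pi0 L \<and> C \<subseteq> E" for E
  proof (rule ccontr)
    assume "E \<noteq> D"
    then have "disjnt E D"
      using E D(1) pairwise_disjoint_path_components_of unfolding pi0_def by (metis pairwiseD)
    then show False
      using E D(2) ne unfolding disjnt_def by blast
  qed
  then have "\<exists>!D. D \<in> pi0 L \<and> C \<subseteq> D"
    using D by blast
  from theI'[OF this] show "pi0_incl L C \<in> pi0 L" "C \<subseteq> pi0_incl L C"
    unfolding pi0_incl_def by auto
qed

lemma ray_complex_subset_nbhd_complex:
  assumes "ep_metric_on Z d" and "\<And>x. x \<in> Z \<Longrightarrow> ep_nbhd Z d x (N x)"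
  shows "ray_complex Z d N t \<subseteq> nbhd_complex Z d N t"
proof
  fix \<sigma> assume "\<sigma> \<in> ray_complex Z d N t"
  then consider x where "x \<in> Z" "\<sigma> = {x}"
    | x y where "x \<in> Z" "y \<in> N x" "d x y \<le> ennreal t" "\<sigma> = {x, y}"
    unfolding ray_complex_def by blast
  then show "\<sigma> \<in> nbhd_complex Z d N t"
  proof cases
    case 1
    then show ?thesis
      using assms unfolding nbhd_complex_def rips_complex_def ep_metric_on_def ep_nbhd_def by auto
  next
    case 2
    then have "y \<in> Z" "x \<in> N x" using assms(2)[of x] unfolding ep_nbhd_def by auto
    then have "d x x = 0" "d y y = 0" "d y x = d x y"
      using 2 assms(1) unfolding ep_metric_on_def by auto
    then have "\<sigma> \<in> rips_complex d t (N x)"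
      using 2 \<open>x \<in> N x\<close> unfolding rips_complex_def by auto
    then show ?thesis using 2 unfolding nbhd_complex_def by blast
  qed
qed

lemma nbhd_complex_subset_rips_complex:
  assumes "\<And>x. x \<in> Z \<Longrightarrow> ep_nbhd Z d x (N x)"
  shows "nbhd_complex Z d N t \<subseteq> rips_complex d t Z"
  using assms unfolding nbhd_complex_def rips_complex_def ep_nbhd_def by blast

lemma ray_complex_mono: "s \<le> t \<Longrightarrow> ray_complex Z d N s \<subseteq> ray_complex Z d N t"
  unfolding ray_complex_def by (auto dest: order_trans[OF _ ennreal_leI])

end

theory Submission
  imports Defs
begin

text \<open>
  Passing from a complex \<open>K\<close> to a larger complex \<open>L\<close> leaves \<open>\<pi>\<^sub>0\<close> unchanged as soon as any two
  vertices of a common simplex of \<open>L\<close> can already be joined by a path in the realization of \<open>K\<close>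
  (\<open>bij_betw_pi0_incl\<close>). Every point of \<open>L\<close> is joined to a vertex inside a closed simplex, which
  makes the map surjective. For injectivity, a path component of \<open>K\<close> determines the union of all
  closed simplices of \<open>L\<close> having a vertex in it. Any closed simplex is either contained in this
  union or disjoint from it, so the union is clopen in the weak topology, and no path in \<open>L\<close> can
  leave it.

  Each map of the theorem satisfies this criterion. If \<open>t \<le> r x\<close> for all \<open>x\<close>, a pair \<open>u, v\<close> with
  \<open>d u v \<le> t\<close> has \<open>v \<in> N u\<close>, so it is an edge of the ray complex; moreover a simplex of diameter
  at most \<open>t\<close> lies in the ball \<open>N x\<close> around any of its vertices \<open>x\<close>, so that the neighbourhood
  complex is all of \<open>V\<^sub>t(Z)\<close>. If \<open>r x \<le> t\<close> for all \<open>x\<close>, every \<open>y \<in> N x\<close> is joined to \<open>x\<close> by a ray, so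
  two vertices of a simplex in \<open>N x\<close> are joined through the centre \<open>x\<close>. The bound \<open>t\<close> on the length
  of rays is then vacuous, so all these ray complexes coincide.
\<close>

section \<open>Paths in closed simplices\<close>

lemma indicator_in_geom_simplex:
  assumes "finite \<sigma>" and "v \<in> \<sigma>"
  shows "indicator {v} \<in> geom_simplex \<sigma>"
  using assms by (auto simp: geom_simplex_def indicator_def)

lemma geom_simplex_Int_nonempty:
  assumes "\<alpha> \<in> geom_simplex \<sigma>" and "\<alpha> \<in> geom_simplex \<tau>"
  shows "\<sigma> \<inter> \<tau> \<noteq> {}"
proof
  assume "\<sigma> \<inter> \<tau> = {}"
  then have "sum \<alpha> \<sigma> = 0"
    using assms by (intro sum.neutral) (auto simp: geom_simplex_def)
  with assms show False by (simp add: geom_simplex_def)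
qed

text \<open>The straight segment lies in the closed simplex, and the weak topology restricts to a
  topology on it that is no finer than pointwise convergence.\<close>

lemma path_component_of_in_geom_simplex:
  assumes "\<sigma> \<in> K" and p: "p \<in> geom_simplex \<sigma>" and q: "q \<in> geom_simplex \<sigma>"
  shows "path_component_of (geom_realization K) p q"
proof -
  define g where "g s = (\<lambda>v. (1 - s) * p v + s * q v)" for s :: real
  have "g s \<in> geom_simplex \<sigma>" if "s \<in> {0..1}" for s
    using that p q
    by (auto simp: g_def geom_simplex_def sum.distrib simp flip: sum_distrib_left)
  moreover have "continuous_on {0..1} g"
    unfolding g_def
    by (intro continuous_on_coordinatewise_then_product continuous_intros)
  ultimately have "continuous_map (top_of_set {0..1}) (top_of_set (geom_simplex \<sigma>)) g"
    by auto
  moreover have "continuous_map (top_of_set (geom_simplex \<sigma>)) (geom_realization K) (\<lambda>\<alpha>. \<alpha>)"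
    unfolding continuous_map_def
  proof (intro conjI allI impI)
    show "(\<lambda>\<alpha>. \<alpha>) \<in> topspace (top_of_set (geom_simplex \<sigma>)) \<rightarrow> topspace (geom_realization K)"
      using \<open>\<sigma> \<in> K\<close> by (auto simp: topspace_geom_realization)
    fix U assume "openin (geom_realization K) U"
    then have "openin (top_of_set (geom_simplex \<sigma>)) (U \<inter> geom_simplex \<sigma>)"
      using \<open>\<sigma> \<in> K\<close> by (auto simp: openin_geom_realization)
    moreover have "{\<alpha> \<in> topspace (top_of_set (geom_simplex \<sigma>)). \<alpha> \<in> U} = U \<inter> geom_simplex \<sigma>"
      by auto
    ultimately show "openin (top_of_set (geom_simplex \<sigma>))
        {\<alpha> \<in> topspace (top_of_set (geom_simplex \<sigma>)). \<alpha> \<in> U}"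
      by simp
  qed
  ultimately have "continuous_map (top_of_set {0..1}) (geom_realization K) ((\<lambda>\<alpha>. \<alpha>) \<circ> g)"
    by (rule continuous_map_compose)
  then have "pathin (geom_realization K) g"
    by (simp add: pathin_def o_def)
  moreover have "g 0 = p" "g 1 = q"
    by (simp_all add: g_def)
  ultimately show ?thesis
    unfolding path_component_of_def by blast
qed

section \<open>A criterion for an inclusion to induce a bijection of path components\<close>

lemma eq_path_component_of_set:
  assumes "C \<in> path_components_of X" and "p \<in> C"
  shows "C = Collect (path_component_of X p)"
  using assms path_component_of_equiv unfolding path_components_of_def
  by (metis (no_types, lifting) imageE mem_Collect_eq)

text \<open>A union of closed simplices that is saturated, in the sense that every closed simplex meeting
  it lies in it, traces the empty or the full set on each closed simplex; hence both it and its
  complement are open in the weak topology.\<close>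

lemma path_component_of_in_saturated:
  assumes sat: "\<And>\<tau>. \<tau> \<in> L \<Longrightarrow> geom_simplex \<tau> \<inter> U \<noteq> {} \<Longrightarrow> geom_simplex \<tau> \<subseteq> U"
    and pq: "path_component_of (geom_realization L) p q" and "p \<in> U"
  shows "q \<in> U"
proof (rule ccontr)
  let ?X = "geom_realization L"
  assume "q \<notin> U"
  have trace: "U \<inter> geom_simplex \<tau> = {} \<or> U \<inter> geom_simplex \<tau> = geom_simplex \<tau>" if "\<tau> \<in> L" for \<tau>
    using sat[OF that] by blast
  have "openin ?X (topspace ?X \<inter> U)"
    unfolding openin_geom_realization topspace_geom_realization
  proof (intro conjI ballI)
    fix \<tau> assume "\<tau> \<in> L"
    then have "(\<Union>(geom_simplex ` L) \<inter> U) \<inter> geom_simplex \<tau> = U \<inter> geom_simplex \<tau>" by blast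
    with trace[OF \<open>\<tau> \<in> L\<close>]
    show "openin (top_of_set (geom_simplex \<tau>)) ((\<Union>(geom_simplex ` L) \<inter> U) \<inter> geom_simplex \<tau>)"
      by (metis openin_empty openin_subtopology_self)
  qed blast
  moreover have "openin ?X (topspace ?X - U)"
    unfolding openin_geom_realization topspace_geom_realization
  proof (intro conjI ballI)
    fix \<tau> assume "\<tau> \<in> L"
    then have "(\<Union>(geom_simplex ` L) - U) \<inter> geom_simplex \<tau> = {} \<or>
        (\<Union>(geom_simplex ` L) - U) \<inter> geom_simplex \<tau> = geom_simplex \<tau>"
      using trace[OF \<open>\<tau> \<in> L\<close>] by blast
    then show "openin (top_of_set (geom_simplex \<tau>)) ((\<Union>(geom_simplex ` L) - U) \<inter> geom_simplex \<tau>)"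
      by (metis openin_empty openin_subtopology_self)
  qed blast
  moreover have "topspace ?X - (topspace ?X \<inter> U) = topspace ?X - U" by blast
  ultimately have "closedin ?X (topspace ?X \<inter> U)" "openin ?X (topspace ?X \<inter> U)"
    by (auto simp: closedin_def)
  moreover have "connectedin ?X (Collect (path_component_of ?X p))"
    by (intro path_connectedin_imp_connectedin path_connectedin_path_component_of)
  ultimately have "Collect (path_component_of ?X p) \<subseteq> topspace ?X \<inter> U \<or>
      disjnt (Collect (path_component_of ?X p)) (topspace ?X \<inter> U)"
    by (meson connectedin_clopen_cases)
  moreover have "path_component_of ?X p p" "p \<in> topspace ?X"
    using pq path_component_of_equiv path_component_of_refl by metis+
  ultimately show False
    using pq \<open>p \<in> U\<close> \<open>q \<notin> U\<close> by (auto simp: disjnt_iff)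
qed

text \<open>The hypothesis on \<open>K\<close> with \<open>u = v\<close> says that \<open>K\<close> contains all vertices of \<open>L\<close>.\<close>

lemma bij_betw_pi0_incl:
  assumes "K \<subseteq> L"
    and simplices: "\<And>\<sigma>. \<sigma> \<in> L \<Longrightarrow> finite \<sigma> \<and> \<sigma> \<noteq> {}"
    and joined: "\<And>\<sigma> u v. \<sigma> \<in> L \<Longrightarrow> u \<in> \<sigma> \<Longrightarrow> v \<in> \<sigma> \<Longrightarrow>
      path_component_of (geom_realization K) (indicator {u}) (indicator {v})"
  shows "bij_betw (pi0_incl L) (pi0 K) (pi0 L)"
  unfolding bij_betw_def
proof
  let ?X = "geom_realization K" and ?Y = "geom_realization L"
  show "inj_on (pi0_incl L) (pi0 K)"
  proof (rule inj_onI)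
    fix C C' assume C: "C \<in> pi0 K" and C': "C' \<in> pi0 K" and eq: "pi0_incl L C = pi0_incl L C'"
    obtain p q where p: "p \<in> C" and q: "q \<in> C'"
      using C C' nonempty_path_components_of unfolding pi0_def by (metis ex_in_conv)
    have "p \<in> pi0_incl L C" "q \<in> pi0_incl L C" "pi0_incl L C \<in> pi0 L"
      using pi0_incl[OF \<open>K \<subseteq> L\<close> C] pi0_incl[OF \<open>K \<subseteq> L\<close> C'] p q eq by auto
    then have pq: "path_component_of ?Y p q"
      using eq_path_component_of_set unfolding pi0_def by (metis mem_Collect_eq)
    have "p \<in> topspace ?X" "q \<in> topspace ?X"
      using p q C C' path_components_of_subset unfolding pi0_def by blast+
    then obtain \<sigma> \<tau> where \<sigma>: "\<sigma> \<in> K" "p \<in> geom_simplex \<sigma>" and \<tau>: "\<tau> \<in> K" "q \<in> geom_simplex \<tau>"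
      by (auto simp: topspace_geom_realization)
    define U where "U = (\<Union>\<rho>\<in>{\<rho> \<in> L. \<exists>v\<in>\<rho>. path_component_of ?X p (indicator {v})}. geom_simplex \<rho>)"
    have U_simplex: "path_component_of ?X p (indicator {w})"
      if \<rho>: "\<rho> \<in> L" and w: "w \<in> \<rho>" and meets: "geom_simplex \<rho> \<inter> U \<noteq> {}" for \<rho> w
    proof -
      from meets obtain \<alpha> \<rho>' v where \<alpha>: "\<alpha> \<in> geom_simplex \<rho>" "\<alpha> \<in> geom_simplex \<rho>'"
        and \<rho>': "\<rho>' \<in> L" "v \<in> \<rho>'" and v: "path_component_of ?X p (indicator {v})"
        unfolding U_def by blast
      from geom_simplex_Int_nonempty[OF \<alpha>] obtain x where "x \<in> \<rho>" "x \<in> \<rho>'" by blast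
      with v \<rho> \<rho>' w joined show ?thesis
        by (meson path_component_of_trans)
    qed
    have "q \<in> U"
    proof (rule path_component_of_in_saturated[OF _ pq])
      fix \<rho> assume \<rho>: "\<rho> \<in> L" and meets: "geom_simplex \<rho> \<inter> U \<noteq> {}"
      obtain w where "w \<in> \<rho>" using simplices[OF \<rho>] by blast
      with U_simplex[OF \<rho> _ meets] \<rho> show "geom_simplex \<rho> \<subseteq> U"
        unfolding U_def by blast
    next
      obtain v where v: "v \<in> \<sigma>" using simplices \<sigma>(1) \<open>K \<subseteq> L\<close> by blast
      then have "path_component_of ?X p (indicator {v})"
        using \<sigma> simplices \<open>K \<subseteq> L\<close>
        by (meson indicator_in_geom_simplex path_component_of_in_geom_simplex subsetD)
      with v \<sigma> \<open>K \<subseteq> L\<close> show "p \<in> U" unfolding U_def by blast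
    qed
    obtain w where w: "w \<in> \<tau>" using simplices \<tau>(1) \<open>K \<subseteq> L\<close> by blast
    have "path_component_of ?X p (indicator {w})"
      using U_simplex[OF _ w] \<tau> \<open>q \<in> U\<close> \<open>K \<subseteq> L\<close> by blast
    moreover have "path_component_of ?X (indicator {w}) q"
      using \<tau> w simplices \<open>K \<subseteq> L\<close>
      by (meson indicator_in_geom_simplex path_component_of_in_geom_simplex subsetD)
    ultimately have "path_component_of ?X p q"
      by (rule path_component_of_trans)
    then show "C = C'"
      using p q C C' eq_path_component_of_set unfolding pi0_def by (metis mem_Collect_eq)
  qed
  show "pi0_incl L ` pi0 K = pi0 L"
  proof
    show "pi0_incl L ` pi0 K \<subseteq> pi0 L"
      using pi0_incl(1)[OF \<open>K \<subseteq> L\<close>] by blast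
    show "pi0 L \<subseteq> pi0_incl L ` pi0 K"
    proof
      fix D assume D: "D \<in> pi0 L"
      obtain p where p: "p \<in> D"
        using D nonempty_path_components_of unfolding pi0_def by (metis ex_in_conv)
      have "p \<in> topspace ?Y"
        using p D path_components_of_subset unfolding pi0_def by blast
      then obtain \<sigma> where \<sigma>: "\<sigma> \<in> L" "p \<in> geom_simplex \<sigma>"
        by (auto simp: topspace_geom_realization)
      obtain v where v: "v \<in> \<sigma>" using simplices \<sigma>(1) by blast
      let ?v = "indicator {v} :: 'a \<Rightarrow> real"
      define C where "C = Collect (path_component_of ?X ?v)"
      have refl: "path_component_of ?X ?v ?v"
        using joined[OF \<sigma>(1) v v] .
      then have "?v \<in> topspace ?X"
        by (simp add: path_component_of_refl)
      then have C: "C \<in> pi0 K"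
        unfolding C_def pi0_def by (simp add: path_component_in_path_components_of)
      have "path_component_of ?Y p ?v"
        using \<sigma> v simplices indicator_in_geom_simplex path_component_of_in_geom_simplex by metis
      then have "?v \<in> D"
        using D p eq_path_component_of_set unfolding pi0_def by (metis mem_Collect_eq)
      moreover have "?v \<in> pi0_incl L C"
        using pi0_incl(2)[OF \<open>K \<subseteq> L\<close> C] refl unfolding C_def by blast
      ultimately have "pi0_incl L C = D"
        using D pi0_incl(1)[OF \<open>K \<subseteq> L\<close> C] eq_path_component_of_set unfolding pi0_def by metis
      with C show "D \<in> pi0_incl L ` pi0 K" by blast
    qed
  qed
qed

lemma path_component_of_vertices:
  assumes "\<sigma> \<in> K" and "finite \<sigma>" and "u \<in> \<sigma>" and "v \<in> \<sigma>"
  shows "path_component_of (geom_realization K) (indicator {u}) (indicator {v})"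
  using assms by (blast intro: path_component_of_in_geom_simplex indicator_in_geom_simplex)

lemma bij_betw_pi0_incl_self:
  assumes "\<And>\<sigma>. \<sigma> \<in> K \<Longrightarrow> finite \<sigma> \<and> \<sigma> \<noteq> {}"
  shows "bij_betw (pi0_incl K) (pi0 K) (pi0 K)"
  using assms by (intro bij_betw_pi0_incl) (auto intro: path_component_of_vertices)

section \<open>Ray, neighbourhood and Vietoris-Rips complexes\<close>

lemma ray_path_component_of:
  assumes "x \<in> Z" and "y \<in> N x" and "d x y \<le> ennreal t"
  shows "path_component_of (geom_realization (ray_complex Z d N t)) (indicator {x}) (indicator {y})"
proof (rule path_component_of_vertices[of "{x, y}"])
  \<comment> \<open>For \<open>y = x\<close> this is the vertex \<open>{x}\<close> rather than an edge.\<close>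
  show "{x, y} \<in> ray_complex Z d N t"
    using assms unfolding ray_complex_def by (cases "y = x") auto
qed auto

lemma nbhd_complex_eq_rips_complex:
  assumes "\<And>x. x \<in> Z \<Longrightarrow> N x = ep_cball Z d x (ennreal (r x))" and "\<And>x. x \<in> Z \<Longrightarrow> t \<le> r x"
  shows "nbhd_complex Z d N t = rips_complex d t Z"
proof
  show "nbhd_complex Z d N t \<subseteq> rips_complex d t Z"
    using assms(1) unfolding nbhd_complex_def rips_complex_def ep_cball_def by blast
  show "rips_complex d t Z \<subseteq> nbhd_complex Z d N t"
  proof
    fix \<sigma> assume \<sigma>: "\<sigma> \<in> rips_complex d t Z"
    then obtain x where x: "x \<in> \<sigma>" "x \<in> Z"
      unfolding rips_complex_def by blast
    have "d x y \<le> ennreal (r x)" if "y \<in> \<sigma>" for y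
    proof -
      have "d x y \<le> ennreal t"
        using \<sigma> x that unfolding rips_complex_def by blast
      also have "\<dots> \<le> ennreal (r x)"
        using assms(2)[OF x(2)] by (rule ennreal_leI)
      finally show ?thesis .
    qed
    then have "\<sigma> \<subseteq> N x"
      using \<sigma> assms(1)[OF x(2)] unfolding rips_complex_def ep_cball_def by blast
    with \<sigma> x show "\<sigma> \<in> nbhd_complex Z d N t"
      unfolding nbhd_complex_def rips_complex_def by blast
  qed
qed

lemma ray_complex_eq_if_radius_le:
  assumes "\<And>x. x \<in> Z \<Longrightarrow> N x = ep_cball Z d x (ennreal (r x))"
    and "\<And>x. x \<in> Z \<Longrightarrow> r x \<le> s" and "s \<le> t"
  shows "ray_complex Z d N s = ray_complex Z d N t"
proof
  show "ray_complex Z d N s \<subseteq> ray_complex Z d N t"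
    using \<open>s \<le> t\<close> by (rule ray_complex_mono)
  have "d x y \<le> ennreal s" if "x \<in> Z" "y \<in> N x" for x y
    using that assms(1)[of x] ennreal_leI[OF assms(2)[of x]]
    unfolding ep_cball_def by (auto intro: order_trans)
  then show "ray_complex Z d N t \<subseteq> ray_complex Z d N s"
    unfolding ray_complex_def by blast
qed

theorem lemma20:
  fixes Z :: "'a set" and d :: "'a \<Rightarrow> 'a \<Rightarrow> ennreal"
    and r :: "'a \<Rightarrow> real" and N :: "'a \<Rightarrow> 'a set" and S t :: real
  assumes "ep_metric_on Z d" and "finite Z"
    and "\<And>x. x \<in> Z \<Longrightarrow> 0 \<le> r x"
    and "\<And>x. x \<in> Z \<Longrightarrow> complete_nbhd Z d x (N x)"
    and "\<And>x. x \<in> Z \<Longrightarrow> N x = ep_cball Z d x (ennreal (r x))"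
    and "0 \<le> S" and "0 \<le> t"
  shows "((\<forall>x\<in>Z. t \<le> r x) \<longrightarrow>
            bij_betw (pi0_incl (nbhd_complex Z d N t))
              (pi0 (ray_complex Z d N t)) (pi0 (nbhd_complex Z d N t)) \<and>
            bij_betw (pi0_incl (rips_complex d t Z))
              (pi0 (nbhd_complex Z d N t)) (pi0 (rips_complex d t Z))) \<and>
         ((\<forall>x\<in>Z. r x \<le> t) \<longrightarrow>
            bij_betw (pi0_incl (nbhd_complex Z d N t))
              (pi0 (ray_complex Z d N t)) (pi0 (nbhd_complex Z d N t))) \<and>
         (S \<le> t \<and> (\<forall>x\<in>Z. r x \<le> S) \<longrightarrow>
            bij_betw (pi0_incl (ray_complex Z d N t))
              (pi0 (ray_complex Z d N S)) (pi0 (ray_complex Z d N t)))"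
proof -
  note ball = assms(5)
  have nbhd: "\<And>x. x \<in> Z \<Longrightarrow> ep_nbhd Z d x (N x)"
    using assms(4) unfolding complete_nbhd_def by blast
  have sub: "ray_complex Z d N t \<subseteq> nbhd_complex Z d N t"
    using assms(1) nbhd by (rule ray_complex_subset_nbhd_complex)
  have simplices: "finite \<sigma> \<and> \<sigma> \<noteq> {}" if "\<sigma> \<in> nbhd_complex Z d N t" for \<sigma>
    using that unfolding nbhd_complex_def rips_complex_def by blast
  have small: "bij_betw (pi0_incl (nbhd_complex Z d N t))
      (pi0 (ray_complex Z d N t)) (pi0 (nbhd_complex Z d N t))" if le: "\<forall>x\<in>Z. t \<le> r x"
  proof (rule bij_betw_pi0_incl[OF sub simplices])
    fix \<sigma> u v assume "\<sigma> \<in> nbhd_complex Z d N t" "u \<in> \<sigma>" "v \<in> \<sigma>"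
    then have uv: "u \<in> Z" "v \<in> Z" "d u v \<le> ennreal t"
      using nbhd unfolding nbhd_complex_def rips_complex_def ep_nbhd_def by blast+
    then have "d u v \<le> ennreal (r u)"
      using le by (meson ennreal_leI order_trans)
    then have "v \<in> N u"
      using uv ball[of u] unfolding ep_cball_def by simp
    with uv show "path_component_of (geom_realization (ray_complex Z d N t))
        (indicator {u}) (indicator {v})"
      by (simp add: ray_path_component_of)
  qed
  have rips: "bij_betw (pi0_incl (rips_complex d t Z))
      (pi0 (nbhd_complex Z d N t)) (pi0 (rips_complex d t Z))" if "\<forall>x\<in>Z. t \<le> r x"
  proof -
    have "nbhd_complex Z d N t = rips_complex d t Z"
      using ball that by (intro nbhd_complex_eq_rips_complex[where r = r]) auto
    then show ?thesis
      using bij_betw_pi0_incl_self[of "nbhd_complex Z d N t"] simplices by auto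
  qed
  have large: "bij_betw (pi0_incl (nbhd_complex Z d N t))
      (pi0 (ray_complex Z d N t)) (pi0 (nbhd_complex Z d N t))" if le: "\<forall>x\<in>Z. r x \<le> t"
  proof (rule bij_betw_pi0_incl[OF sub simplices])
    fix \<sigma> u v assume "\<sigma> \<in> nbhd_complex Z d N t" "u \<in> \<sigma>" "v \<in> \<sigma>"
    then obtain x where x: "x \<in> Z" "u \<in> N x" "v \<in> N x"
      unfolding nbhd_complex_def rips_complex_def by blast
    have "path_component_of (geom_realization (ray_complex Z d N t)) (indicator {x}) (indicator {y})"
      if "y \<in> N x" for y
    proof (rule ray_path_component_of[where N = N, OF x(1) that])
      have "d x y \<le> ennreal (r x)"
        using ball[OF x(1)] that unfolding ep_cball_def by auto
      then show "d x y \<le> ennreal t"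
        using le x(1) by (meson ennreal_leI order_trans)
    qed
    with x show "path_component_of (geom_realization (ray_complex Z d N t))
        (indicator {u}) (indicator {v})"
      by (meson path_component_of_sym path_component_of_trans)
  qed
  have rays: "bij_betw (pi0_incl (ray_complex Z d N t))
      (pi0 (ray_complex Z d N S)) (pi0 (ray_complex Z d N t))" if "S \<le> t" "\<forall>x\<in>Z. r x \<le> S"
  proof -
    have "ray_complex Z d N S = ray_complex Z d N t"
      using ball that by (intro ray_complex_eq_if_radius_le[where r = r]) auto
    then show ?thesis
      using bij_betw_pi0_incl_self[of "ray_complex Z d N t"] simplices sub by auto
  qed
  from small rips large rays show ?thesis by blast
qed

end
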